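(* Fix any $X\in\mathbb{R}^{n\times p}$, $D\in\mathbb{R}^{m\times p}$, and $\lambda>0$. Let $\psi$ be an essentially smooth and essentially strictly convex function on $\mathbb{R}^n$ with $0\in\mathrm{int}(\mathrm{dom}(\psi))$. For $y\in\mathbb{R}^n$ consider the problem $$\min_{\beta\in\mathbb{R}^p}\ -y^TX\beta+\psi(X\beta)+\lambda\|D\beta\|_1 .\qquad (P_y)$$ Fix $y\in\mathcal{N}^c\cap(\mathrm{int}(\mathrm{ran}(\nabla\psi))+C)$. Let $(\hat\beta(y),\hat\gamma(y))$ be an optimal solution-subgradient pair in $(P_y)$, with associated boundary set, boundary signs, active set, and active signs $\mathcal{B}(y),s(y),\mathcal{A}(y),r(y)$, respectively. Then there is a neighborhood $U$ of $y$ such that, for any $y'\in U$, problem $(P_{y'})$ has a solution, and in particular, it has an optimal solution-subgradient pair $(\hat\beta(y'),\hat\gamma(y'))$ with the same boundary set $\mathcal{B}(y')=\mathcal{B}(y)$, boundary signs $s(y')=s(y)$, active set $\mathcal{A}(y')=\mathcal{A}(y)$, and active signs $r(y')=r(y)$.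
   Context: Notation. $A^+$ is the Moore–Penrose pseudoinverse of $A$; $P_L$ is the orthogonal projection onto a linear subspace $L$. For $\mathcal{B}\subseteq\{1,\dots,m\}$, $D_{\mathcal{B}}$ is the submatrix of rows of $D$ indexed by $\mathcal{B}$, and $D_{-\mathcal{B}}=D_{\{1,\dots,m\}\setminus\mathcal{B}}$ (if this has no rows, its null space is $\mathbb{R}^p$). $\mathrm{dom},\mathrm{ran}$ denote domain and range; sums of sets are Minkowski sums. Essentially smooth and essentially strictly convex (Legendre type): $\psi$ is a closed proper convex function, differentiable and strictly convex on the interior of its domain (assumed nonempty), with the norm of its gradient approaching $\infty$ along any sequence approaching the boundary of its domain. $\nabla\psi$ is defined on $\mathrm{int}(\mathrm{dom}(\psi))$. An optimal solution-subgradient pair in $(P_y)$ is a pair $(\hat\beta,\hat\gamma)\in\mathbb{R}^p\times\mathbb{R}^m$ satisfying the KKT conditions $X^T(y-\nabla\psi(X\hat\beta))=\lambda D^T\hat\gamma$, where $\hat\gamma_i=\mathrm{sign}((D\hat\beta)_i)$ if $(D\hat\beta)_i\ne0$ and $\hat\gamma_i\in[-1,1]$ if $(D\hat\beta)_i=0$. Its boundary set is $\mathcal{B}=\{i:|\hat\gamma_i|=1\}$, its boundary signs are $s=\mathrm{sign}(\hat\gamma_{\mathcal{B}})$, its active set is $\mathcal{A}=\{i:(D\hat\beta)_i\ne0\}$, and its active signs are $r=\mathrm{sign}(\hat\gamma_{\mathcal{A}})$. $C=\{v\in\mathbb{R}^n: X^Tv=D^Tu\text{ for some }u\in\mathbb{R}^m,\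 \|u\|_\infty\le\lambda\}$. For $\mathcal{B}\subseteq\{1,\dots,m\}$, $s\in\{-1,1\}^{|\mathcal{B}|}$: $$K_{\mathcal{B},s}=\lambda(P_{\mathrm{null}(D_{-\mathcal{B}})}X^T)^+D_{\mathcal{B}}^Ts+\mathrm{null}(P_{\mathrm{null}(D_{-\mathcal{B}})}X^T).$$ For $\mathcal{A}\subseteq\mathcal{B}\subseteq\{1,\dots,m\}$: $$M_{\mathcal{A},\mathcal{B}}=P_{[D_{\mathcal{B}\setminus\mathcal{A}}(\mathrm{null}(X)\cap\mathrm{null}(D_{-\mathcal{B}}))]^\perp}\,D_{\mathcal{B}\setminus\mathcal{A}}\,(XP_{\mathrm{null}(D_{-\mathcal{B}})})^+,$$ with $M_{\mathcal{A},\mathcal{B}}=0$ by convention when $\mathcal{A}=\mathcal{B}$. Then $$\mathcal{N}=\bigcup_{\mathcal{A},\mathcal{B},s:\ M_{\mathcal{A},\mathcal{B}}\ne0}\Big(K_{\mathcal{B},s}+\nabla\psi\big(\mathrm{col}(XP_{\mathrm{null}(D_{-\mathcal{B}})})\cap\mathrm{null}(M_{\mathcal{A},\mathcal{B}})\cap\mathrm{int}(\mathrm{dom}(\psi))\big)\Big),$$ the union being over all $\mathcal{A}\subseteq\mathcal{B}\subseteq\{1,\dots,m\}$ and $s\in\{-1,1\}^{|\mathcal{B}|}$ with $M_{\mathcal{A},\mathcal{B}}\neq0$. *)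

theory Defs
  imports "HOL-Analysis.Analysis"
begin

section \<open>Linear algebra\<close>

definition null_space :: "real^'n^'m \<Rightarrow> (real^'n) set" where
  "null_space A = {x. A *v x = 0}"

definition col_space :: "real^'n^'m \<Rightarrow> (real^'m) set" where
  "col_space A = span (columns A)"

definition proj_mat :: "(real^'n) set \<Rightarrow> real^'n^'n" where
  "proj_mat L = (THE P. \<forall>x. P *v x \<in> L \<and> x - P *v x \<in> L\<^sup>\<bottom>)"

text \<open>The Moore--Penrose pseudoinverse, given by the four Penrose equations.\<close>

definition pinv :: "real^'n^'m \<Rightarrow> real^'m^'n" where
  "pinv A = (THE B. A ** B ** A = A \<and> B ** A ** B = B \<and>
                    transpose (A ** B) = A ** B \<and> transpose (B ** A) = B ** A)"

text \<open>Row submatrices \<open>D\<^sub>B\<close> and subvectors \<open>v\<^sub>B\<close> keep the full index type: the entries outside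
  \<open>B\<close> are set to zero, i.e. the coordinate space indexed by \<open>B\<close> is embedded in the one indexed
  by \<open>'m\<close>. This changes neither null spaces, nor \<open>D\<^sub>B\<^sup>T v\<^sub>B\<close>, nor which products vanish.
  For empty \<open>B\<close> the null space of \<open>D\<^sub>B\<close> is the whole space.\<close>

definition rows_in :: "'m set \<Rightarrow> real^'p^'m \<Rightarrow> real^'p^'m" where
  "rows_in B D = (\<chi> i. if i \<in> B then D $ i else 0)"

definition entries_in :: "'m set \<Rightarrow> real^'m \<Rightarrow> real^'m" where
  "entries_in B v = (\<chi> i. if i \<in> B then v $ i else 0)"

definition sign_vectors :: "'m set \<Rightarrow> (real^'m) set" where
  "sign_vectors B = {s. \<forall>i. if i \<in> B then s $ i \<in> {-1, 1} else s $ i = 0}"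

definition sgn_vec :: "real^'m \<Rightarrow> real^'m" where
  "sgn_vec v = (\<chi> i. sgn (v $ i))"

section \<open>Convex functions of Legendre type\<close>

definition edom :: "('a \<Rightarrow> ereal) \<Rightarrow> 'a set" where
  "edom \<psi> = {x. \<psi> x < \<infinity>}"

definition epi :: "('a \<Rightarrow> ereal) \<Rightarrow> ('a \<times> real) set" where
  "epi \<psi> = {(x, t). \<psi> x \<le> ereal t}"

definition closed_proper_convex :: "('a::euclidean_space \<Rightarrow> ereal) \<Rightarrow> bool" where
  "closed_proper_convex \<psi> \<longleftrightarrow>
     closed (epi \<psi>) \<and> convex (epi \<psi>) \<and> edom \<psi> \<noteq> {} \<and> (\<forall>x. \<psi> x \<noteq> -\<infinity>)"

text \<open>Only used at points of the interior of the domain, where \<open>\<psi>\<close> is finite.\<close>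

definition grad :: "('a::euclidean_space \<Rightarrow> ereal) \<Rightarrow> 'a \<Rightarrow> 'a" where
  "grad \<psi> x = (THE g. GDERIV (\<lambda>z. real_of_ereal (\<psi> z)) x :> g)"

definition legendre_type :: "('a::euclidean_space \<Rightarrow> ereal) \<Rightarrow> bool" where
  "legendre_type \<psi> \<longleftrightarrow>
     closed_proper_convex \<psi> \<and>
     interior (edom \<psi>) \<noteq> {} \<and>
     (\<forall>x \<in> interior (edom \<psi>). (\<lambda>z. real_of_ereal (\<psi> z)) differentiable (at x)) \<and>
     (\<forall>x \<in> interior (edom \<psi>). \<forall>y \<in> interior (edom \<psi>). \<forall>u v. x \<noteq> y \<and> 0 < u \<and> 0 < v \<and> u + v = 1 \<longrightarrow>
        \<psi> (u *\<^sub>R x + v *\<^sub>R y) < ereal u * \<psi> x + ereal v * \<psi> y) \<and>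
     (\<forall>z x. (\<forall>k::nat. z k \<in> interior (edom \<psi>)) \<and> x \<in> frontier (edom \<psi>) \<and> z \<longlonglongrightarrow> x \<longrightarrow>
        filterlim (\<lambda>k. norm (grad \<psi> (z k))) at_top sequentially)"

section \<open>The generalized lasso problem\<close>

definition objective ::
    "real^'p^'n \<Rightarrow> real^'p^'m \<Rightarrow> real \<Rightarrow> (real^'n \<Rightarrow> ereal) \<Rightarrow> real^'n \<Rightarrow> real^'p \<Rightarrow> ereal" where
  "objective X D l \<psi> y \<beta> =
     ereal (- (y \<bullet> (X *v \<beta>))) + \<psi> (X *v \<beta>) + ereal (l * (\<Sum>i\<in>UNIV. \<bar>(D *v \<beta>) $ i\<bar>))"

definition is_solution ::
    "real^'p^'n \<Rightarrow> real^'p^'m \<Rightarrow> real \<Rightarrow> (real^'n \<Rightarrow> ereal) \<Rightarrow> real^'n \<Rightarrow> real^'p \<Rightarrow> bool" where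
  "is_solution X D l \<psi> y \<beta> \<longleftrightarrow> is_arg_min (objective X D l \<psi> y) (\<lambda>_. True) \<beta>"

text \<open>The first conjunct makes the gradient in the stationarity equation meaningful.\<close>

definition kkt_pair ::
    "real^'p^'n \<Rightarrow> real^'p^'m \<Rightarrow> real \<Rightarrow> (real^'n \<Rightarrow> ereal) \<Rightarrow> real^'n \<Rightarrow> real^'p \<Rightarrow> real^'m \<Rightarrow> bool" where
  "kkt_pair X D l \<psi> y \<beta> \<gamma> \<longleftrightarrow>
     X *v \<beta> \<in> interior (edom \<psi>) \<and>
     transpose X *v (y - grad \<psi> (X *v \<beta>)) = l *\<^sub>R (transpose D *v \<gamma>) \<and>
     (\<forall>i. if (D *v \<beta>) $ i \<noteq> 0 then \<gamma> $ i = sgn ((D *v \<beta>) $ i) else \<gamma> $ i \<in> {-1..1})"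

definition boundary_set :: "real^'m \<Rightarrow> 'm set" where
  "boundary_set \<gamma> = {i. \<bar>\<gamma> $ i\<bar> = 1}"

definition boundary_signs :: "real^'m \<Rightarrow> real^'m" where
  "boundary_signs \<gamma> = entries_in (boundary_set \<gamma>) (sgn_vec \<gamma>)"

definition active_set :: "real^'p^'m \<Rightarrow> real^'p \<Rightarrow> 'm set" where
  "active_set D \<beta> = {i. (D *v \<beta>) $ i \<noteq> 0}"

definition active_signs :: "real^'p^'m \<Rightarrow> real^'p \<Rightarrow> real^'m \<Rightarrow> real^'m" where
  "active_signs D \<beta> \<gamma> = entries_in (active_set D \<beta>) (sgn_vec \<gamma>)"

section \<open>The sets \<open>C\<close>, \<open>K\<close> and \<open>N\<close>\<close>

definition C_set :: "real^'p^'n \<Rightarrow> real^'p^'m \<Rightarrow> real \<Rightarrow> (real^'n) set" where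
  "C_set X D l = {v. \<exists>u. transpose X *v v = transpose D *v u \<and> infnorm u \<le> l}"

definition K_set ::
    "real^'p^'n \<Rightarrow> real^'p^'m \<Rightarrow> real \<Rightarrow> 'm set \<Rightarrow> real^'m \<Rightarrow> (real^'n) set" where
  "K_set X D l B s =
     (let PXt = proj_mat (null_space (rows_in (- B) D)) ** transpose X
      in {l *\<^sub>R (pinv PXt *v (transpose (rows_in B D) *v s))} + null_space PXt)"

text \<open>The orthogonal complement is taken in the space indexed by all of \<open>'m\<close>; the projection preserves
  the vectors supported on \<open>B - A\<close> and acts on them as the projection within that coordinate
  subspace. For \<open>A = B\<close> the factor \<open>rows_in (B - A) D\<close> is zero, hence so is \<open>M_mat X D A B\<close>.\<close>

definition M_mat :: "real^'p^'n \<Rightarrow> real^'p^'m \<Rightarrow> 'm set \<Rightarrow> 'm set \<Rightarrow> real^'n^'m" where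
  "M_mat X D A B =
     (let L = null_space (rows_in (- B) D); DBA = rows_in (B - A) D
      in proj_mat (((\<lambda>x. DBA *v x) ` (null_space X \<inter> L))\<^sup>\<bottom>) ** DBA ** pinv (X ** proj_mat L))"

definition N_set ::
    "real^'p^'n \<Rightarrow> real^'p^'m \<Rightarrow> real \<Rightarrow> (real^'n \<Rightarrow> ereal) \<Rightarrow> (real^'n) set" where
  "N_set X D l \<psi> =
     \<Union> {K_set X D l B s +
          grad \<psi> ` (col_space (X ** proj_mat (null_space (rows_in (- B) D)))
                      \<inter> null_space (M_mat X D A B) \<inter> interior (edom \<psi>))
         | A B s. A \<subseteq> B \<and> s \<in> sign_vectors B \<and> M_mat X D A B \<noteq> 0}"

end

theory Submission
  imports Defs
begin

text \<open>
  Let \<open>A \<subseteq> B\<close> be the active and the boundary set of the given pair and \<open>L\<^sub>A \<subseteq> L\<^sub>B\<close> the null spaces of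
  \<open>D\<^sub>-\<^sub>A\<close> and \<open>D\<^sub>-\<^sub>B\<close>. As \<open>y\<close> lies outside the exceptional set, the matrix \<open>M\<close> of the pair vanishes,
  which says that \<open>X L\<^sub>A = X L\<^sub>B =: V\<close>. The stationarity condition tested on \<open>L\<^sub>B\<close> then becomes a condition
  on the fitted value alone: for the datum \<open>y'\<close> one needs a point \<open>z' \<in> V\<close> near \<open>z = X \<beta>\<close> such that
  \<open>\<nabla>\<psi>(z') - \<nabla>\<psi>(z) - (y' - y)\<close> is orthogonal to \<open>V\<close>. It exists by strict convexity. A linear right
  inverse of \<open>X\<close> with values in \<open>L\<^sub>A\<close> lifts it to a \<open>\<beta>'\<close> near \<open>\<beta>\<close>. The remaining stationarity residual is
  orthogonal to \<open>L\<^sub>B\<close>, hence in the range of the transpose of \<open>D\<^sub>-\<^sub>B\<close>, and it is small because \<open>\<nabla>\<psi>\<close> is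
  continuous; so it is absorbed by a small change of \<open>\<gamma>\<close> off \<open>B\<close>, where \<open>\<bar>\<gamma>\<bar> < 1\<close>.
\<close>

section \<open>Orthogonal projections and pseudoinverses\<close>

lemma inner_transpose: "(transpose A *v x) \<bullet> y = x \<bullet> ((A :: real^'n^'m) *v y)"
  by (metis dot_lmul_matrix transpose_matrix_vector)

lemma subspace_null_space: "subspace (null_space A)"
  unfolding null_space_def
  by (auto simp: subspace_def matrix_vector_right_distrib matrix_vector_mult_scaleR)

text \<open>A vector is killed by \<open>A\<close> exactly when it is orthogonal to the range of
  \<open>transpose A\<close>; taking complements again returns that range. Orthogonality to a null
  space thus becomes solvability of a linear system.\<close>

lemma orthogonal_comp_null_space:
  "(null_space (A :: real^'n^'m))\<^sup>\<bottom> = range ((*v) (transpose A))"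
proof -
  have "null_space A = (range ((*v) (transpose A)))\<^sup>\<bottom>"
    unfolding null_space_def orthogonal_comp_def orthogonal_def
    by (auto simp: inner_transpose simp del: transpose_matrix_vector) (metis inner_eq_zero_iff)
  moreover have "subspace (range ((*v) (transpose A)))"
    by (intro linear_subspace_image matrix_vector_mul_linear subspace_UNIV)
  ultimately show ?thesis
    by (simp add: orthogonal_comp_self)
qed

lemma orthogonal_decomposition_unique:
  assumes "subspace L" "y \<in> L" "x - y \<in> L\<^sup>\<bottom>" "z \<in> L" "x - z \<in> L\<^sup>\<bottom>"
  shows "y = z"
proof -
  have "(y - z) \<bullet> (x - z) = 0" "(y - z) \<bullet> (x - y) = 0"
    using assms subspace_diff[OF assms(1), of y z]
    by (auto simp: orthogonal_comp_def orthogonal_def)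
  then have "(y - z) \<bullet> (y - z) = 0"
    by (simp add: inner_diff_left inner_diff_right inner_commute)
  then show ?thesis by simp
qed

text \<open>Decomposing each vector along \<open>L\<close> and its complement defines a map, and
  uniqueness of the decomposition forces it to be linear, hence a matrix.\<close>

lemma proj_mat_exists:
  assumes L: "subspace (L :: (real^'n) set)"
  shows "\<exists>P :: real^'n^'n. \<forall>x. P *v x \<in> L \<and> x - P *v x \<in> L\<^sup>\<bottom>"
proof -
  have "\<forall>x. \<exists>y. y \<in> L \<and> x - y \<in> L\<^sup>\<bottom>"
  proof
    fix x
    obtain a b where "a \<in> L" "b \<in> L\<^sup>\<bottom>" "x = a + b"
      using subspace_sum_orthogonal_comp[OF L] by (metis UNIV_I set_plus_elim)
    then show "\<exists>y. y \<in> L \<and> x - y \<in> L\<^sup>\<bottom>" by (intro exI[of _ a]) auto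
  qed
  then obtain p where p: "\<And>x. p x \<in> L" "\<And>x. x - p x \<in> L\<^sup>\<bottom>" by metis
  note C = subspace_orthogonal_comp[of L]
  have "linear p"
  proof (rule linearI)
    fix x y
    have "x - p x + (y - p y) \<in> L\<^sup>\<bottom>" by (intro subspace_add C p)
    then have "(x + y) - (p x + p y) \<in> L\<^sup>\<bottom>" by (simp add: algebra_simps)
    then show "p (x + y) = p x + p y"
      using orthogonal_decomposition_unique[OF L, of "p (x + y)" "x + y" "p x + p y"]
        p subspace_add[OF L] by auto
  next
    fix c x
    have "c *\<^sub>R (x - p x) \<in> L\<^sup>\<bottom>" by (intro subspace_scale C p)
    then have "c *\<^sub>R x - c *\<^sub>R p x \<in> L\<^sup>\<bottom>" by (simp add: algebra_simps)
    then show "p (c *\<^sub>R x) = c *\<^sub>R p x"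
      using orthogonal_decomposition_unique[OF L, of "p (c *\<^sub>R x)" "c *\<^sub>R x" "c *\<^sub>R p x"]
        p subspace_scale[OF L] by auto
  qed
  then show ?thesis using p by (intro exI[of _ "matrix p"]) (simp add: matrix_works)
qed

lemma proj_mat_works:
  assumes L: "subspace (L :: (real^'n) set)"
  shows proj_mat_in: "proj_mat L *v x \<in> L"
    and proj_mat_diff: "x - proj_mat L *v x \<in> L\<^sup>\<bottom>"
proof -
  obtain P :: "real^'n^'n" where P: "\<forall>x. P *v x \<in> L \<and> x - P *v x \<in> L\<^sup>\<bottom>"
    using proj_mat_exists[OF L] by blast
  have "\<forall>x. proj_mat L *v x \<in> L \<and> x - proj_mat L *v x \<in> L\<^sup>\<bottom>"
    unfolding proj_mat_def
  proof (rule theI)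
    fix Q :: "real^'n^'n" assume Q: "\<forall>x. Q *v x \<in> L \<and> x - Q *v x \<in> L\<^sup>\<bottom>"
    have "Q *v x = P *v x" for x
      using P Q orthogonal_decomposition_unique[OF L] by blast
    then show "Q = P" by (simp add: matrix_eq)
  qed (use P in blast)
  then show "proj_mat L *v x \<in> L" "x - proj_mat L *v x \<in> L\<^sup>\<bottom>" by auto
qed

lemma proj_mat_eqI:
  assumes "subspace L" "y \<in> L" "x - y \<in> L\<^sup>\<bottom>"
  shows "proj_mat L *v x = y"
  using assms orthogonal_decomposition_unique proj_mat_in proj_mat_diff by blast

lemma proj_mat_id: "subspace L \<Longrightarrow> x \<in> L \<Longrightarrow> proj_mat L *v x = x"
  by (intro proj_mat_eqI) (auto simp: orthogonal_comp_def orthogonal_def)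

lemma proj_mat_zero_iff:
  assumes L: "subspace L"
  shows "proj_mat L *v x = 0 \<longleftrightarrow> x \<in> L\<^sup>\<bottom>"
  using proj_mat_eqI[OF L subspace_0[OF L], of x] proj_mat_diff[OF L, of x] by auto

lemma proj_mat_inner:
  assumes L: "subspace L"
  shows "(proj_mat L *v x) \<bullet> y = x \<bullet> (proj_mat L *v y)"
proof -
  have "(proj_mat L *v x) \<bullet> (y - proj_mat L *v y) = 0"
       "(proj_mat L *v y) \<bullet> (x - proj_mat L *v x) = 0"
    using proj_mat_in[OF L] proj_mat_diff[OF L]
    by (auto simp: orthogonal_comp_def orthogonal_def)
  then show ?thesis by (simp add: inner_diff_right inner_commute)
qed

lemma transpose_proj_mat:
  assumes L: "subspace L"
  shows "transpose (proj_mat L) = proj_mat L"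
proof -
  have "transpose (proj_mat L) *v x = proj_mat L *v x" for x
    by (subst vector_eq_rdot[symmetric]) (simp add: inner_transpose proj_mat_inner[OF L] del: transpose_matrix_vector)
  then show ?thesis by (simp add: matrix_eq)
qed

section \<open>The Moore-Penrose pseudoinverse\<close>

definition penrose :: "real^'n^'m \<Rightarrow> real^'m^'n \<Rightarrow> bool" where
  "penrose A B \<longleftrightarrow> A ** B ** A = A \<and> B ** A ** B = B \<and>
     transpose (A ** B) = A ** B \<and> transpose (B ** A) = B ** A"

text \<open>\<open>A\<close> maps the complement of its null space onto its range. Projecting onto
  the range and inverting there gives \<open>B\<close>; both products are then orthogonal
  projections, which makes them symmetric.\<close>

lemma penrose_exists: "\<exists>B. penrose (A :: real^'n^'m) B"
proof -
  let ?R = "range ((*v) A)" and ?N = "(null_space A)\<^sup>\<bottom>"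
  have R: "subspace ?R"
    by (intro linear_subspace_image matrix_vector_mul_linear subspace_UNIV)
  have N: "subspace ?N" by (rule subspace_orthogonal_comp)
  have NN: "?N\<^sup>\<bottom> = null_space A" by (intro orthogonal_comp_self subspace_null_space)
  have RN: "?R = (*v) A ` ?N"
  proof -
    have "A *v x = A *v (proj_mat ?N *v x)" for x
      using proj_mat_diff[OF N, of x] unfolding NN
      by (simp add: null_space_def matrix_vector_mult_diff_distrib)
    then show ?thesis using proj_mat_in[OF N] by blast
  qed
  obtain g where g: "range g \<subseteq> ?N" "linear g" "\<forall>v\<in>?R. A *v g v = v"
    using linear_exists_right_inverse_on[OF matrix_vector_mul_linear[of A] N] RN by auto
  define B where "B = matrix g ** proj_mat ?R"
  have B: "B *v x = g (proj_mat ?R *v x)" for x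
    by (simp add: B_def matrix_vector_mul_assoc[symmetric] matrix_works g)
  have AB: "A ** B = proj_mat ?R"
    using bspec[OF g(3) proj_mat_in[OF R]]
    by (simp add: matrix_eq matrix_vector_mul_assoc[symmetric] B)
  have BA: "B ** A = proj_mat ?N"
  proof -
    have "proj_mat ?N *v x = B *v (A *v x)" for x
    proof (rule proj_mat_eqI[OF N])
      have *: "B *v (A *v x) = g (A *v x)"
        by (simp add: B proj_mat_id[OF R])
      show "B *v (A *v x) \<in> ?N" using g(1) * by auto
      show "x - B *v (A *v x) \<in> ?N\<^sup>\<bottom>"
        unfolding NN * using g(3) by (simp add: null_space_def matrix_vector_mult_diff_distrib)
    qed
    then show ?thesis by (simp add: matrix_eq matrix_vector_mul_assoc[symmetric])
  qed
  have "A ** B ** A = A"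
    unfolding AB
    by (simp add: matrix_eq matrix_vector_mul_assoc[symmetric] proj_mat_id[OF R])
  moreover have "B ** A ** B = B"
    unfolding matrix_mul_assoc[symmetric] AB
    by (simp add: matrix_eq matrix_vector_mul_assoc[symmetric] B proj_mat_id[OF R] proj_mat_in[OF R])
  ultimately show ?thesis
    unfolding penrose_def using AB BA transpose_proj_mat[OF R] transpose_proj_mat[OF N] by metis
qed

text \<open>Transposing the symmetric products yields \<open>A ** B = A ** C\<close> and
  \<open>B ** A = C ** A\<close>; then B = BAB = BAC = CAC = C.\<close>

lemma penrose_unique:
  assumes B: "penrose A B" and C: "penrose A C"
  shows "B = C"
proof -
  have AB: "A ** B = A ** C"
  proof -
    have "A ** B = transpose B ** transpose (A ** C ** A)"
      using B C unfolding penrose_def by (metis matrix_transpose_mul)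
    also have "\<dots> = transpose (A ** B) ** transpose (A ** C)"
      using C unfolding penrose_def
      by (metis matrix_transpose_mul matrix_mul_assoc)
    also have "\<dots> = A ** C"
      using B C unfolding penrose_def by (metis matrix_mul_assoc)
    finally show ?thesis .
  qed
  have BA: "B ** A = C ** A"
  proof -
    have "B ** A = transpose (A ** C ** A) ** transpose B"
      using B C unfolding penrose_def by (metis matrix_transpose_mul)
    also have "\<dots> = transpose (C ** A) ** transpose (B ** A)"
      using C unfolding penrose_def
      by (metis matrix_transpose_mul matrix_mul_assoc)
    also have "\<dots> = C ** A"
      using B C unfolding penrose_def by (metis matrix_mul_assoc)
    finally show ?thesis .
  qed
  show ?thesis
    using AB BA B C unfolding penrose_def by (metis matrix_mul_assoc)
qed

lemma penrose_pinv: "penrose A (pinv A)"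
proof -
  have "penrose A (THE B. penrose A B)"
    using penrose_exists penrose_unique by (metis theI)
  then show ?thesis by (simp add: pinv_def penrose_def)
qed

lemma mult_pinv_mult: "A *v (pinv A *v (A *v x)) = A *v x"
  using penrose_pinv[of A] unfolding penrose_def
  by (metis matrix_vector_mul_assoc)

lemma pinv_in_orthogonal_comp: "pinv A *v x \<in> (null_space A)\<^sup>\<bottom>"
proof -
  \<comment> \<open>With B the pseudoinverse, B = BAB and BA is symmetric, so B = A^T B^T B.\<close>
  have "pinv A = transpose A ** (transpose (pinv A) ** pinv A)"
    using penrose_pinv[of A] unfolding penrose_def
    by (metis matrix_transpose_mul matrix_mul_assoc)
  then have "pinv A *v x = transpose A *v ((transpose (pinv A) ** pinv A) *v x)"
    by (metis matrix_vector_mul_assoc)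
  then show ?thesis unfolding orthogonal_comp_null_space by blast
qed

lemma mult_pinv_transpose: "transpose A *v x = 0 \<Longrightarrow> A *v (pinv A *v x) = 0"
proof -
  assume x: "transpose A *v x = 0"
  have "A ** pinv A = transpose (pinv A) ** transpose A"
    using penrose_pinv[of A] unfolding penrose_def by (metis matrix_transpose_mul)
  then show ?thesis
    using x by (metis matrix_vector_mul_assoc matrix_vector_mult_0_right)
qed

section \<open>Convex differentiable functions\<close>

text \<open>Differentiability at \<open>z\<close> keeps \<open>f\<close> close to one affine
  function near \<open>z\<close>. The tangent plane at a nearby \<open>x\<close> lies below
  \<open>f\<close>, so its slope cannot exceed \<open>g z\<close> by much in any direction.\<close>

lemma grad_continuous:
  fixes f :: "'a::euclidean_space \<Rightarrow> real"
  assumes S: "open S" "z \<in> S" and f: "GDERIV f z :> g z"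
    and tangent: "\<And>x w. x \<in> S \<Longrightarrow> w \<in> S \<Longrightarrow> f x + g x \<bullet> (w - x) \<le> f w"
    and e: "e > 0"
  shows "\<exists>d>0. \<forall>x\<in>S. norm (x - z) < d \<longrightarrow> norm (g x - g z) \<le> e"
proof -
  obtain r1 where r1: "r1 > 0" "ball z r1 \<subseteq> S" using S open_contains_ball by blast
  \<comment> \<open>The error \<open>e / 3\<close> per unit length is spent over at most
    \<open>2 * t\<close> at \<open>w\<close> and at most \<open>t\<close> at \<open>x\<close>, in
    total \<open>e * t\<close>.\<close>
  obtain r2 where r2: "r2 > 0"
      "\<And>w. norm (w - z) < r2 \<Longrightarrow> norm (f w - f z - (w - z) \<bullet> g z) \<le> e / 3 * norm (w - z)"
    using f e unfolding gderiv_def has_derivative_at_alt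
    by (metis divide_pos_pos zero_less_numeral)
  define t where "t = min r1 r2 / 3"
  have t: "t > 0" "3 * t \<le> r1" "3 * t \<le> r2" using r1 r2 by (auto simp: t_def)
  show ?thesis
  proof (intro exI[of _ t] conjI ballI impI)
    fix x assume x: "x \<in> S" "norm (x - z) < t"
    \<comment> \<open>In the direction of the gradient difference the inner product becomes its
      norm; if the difference vanishes, \<open>u\<close> is 0.\<close>
    define u where "u = sgn (g x - g z)"
    define w where "w = x + t *\<^sub>R u"
    have nu: "norm u \<le> 1" by (simp add: u_def norm_sgn)
    have "norm (w - z) \<le> norm (x - z) + norm (t *\<^sub>R u)"
      using norm_triangle_ineq[of "x - z" "t *\<^sub>R u"] by (simp add: w_def algebra_simps)
    also have "\<dots> \<le> norm (x - z) + t" using nu t by (simp add: mult_left_le)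
    finally have nw: "norm (w - z) \<le> 2 * t" using x by simp
    have "w \<in> S" using nw t r1 by (auto simp: subset_eq dist_norm norm_minus_commute)
    then have "f x + t * (u \<bullet> g x) \<le> f w"
      using tangent[OF x(1), of w] by (simp add: w_def inner_commute)
    moreover have "f w - f z - (w - z) \<bullet> g z \<le> e / 3 * (2 * t)"
      using r2(2)[of w] nw t e by (smt (verit) mult_left_mono divide_pos_pos real_norm_def)
    moreover have "f x - f z - (x - z) \<bullet> g z \<ge> - (e / 3 * t)"
      using r2(2)[of x] x t e by (smt (verit) mult_left_mono divide_pos_pos real_norm_def)
    moreover have "(w - z) \<bullet> g z = (x - z) \<bullet> g z + t * (u \<bullet> g z)"
      by (simp add: w_def inner_diff_left inner_add_left)
    ultimately have "t * (u \<bullet> (g x - g z)) \<le> e * t"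
      by (simp add: inner_diff_right algebra_simps)
    then have "u \<bullet> (g x - g z) \<le> e" using t(1) by (simp add: mult.commute)
    moreover have "u \<bullet> (g x - g z) = norm (g x - g z)"
      by (cases "g x = g z")
         (simp_all add: u_def sgn_div_norm power2_norm_eq_inner[symmetric] power2_eq_square)
    ultimately show "norm (g x - g z) \<le> e" by simp
  qed (use t in simp)
qed

text \<open>The solution is the minimizer of the tilted function over a small ball of the subspace: strict
  convexity keeps it away from the boundary sphere while the tilt is small.\<close>

lemma perturbed_stationary_point:
  fixes f :: "'a::euclidean_space \<Rightarrow> real"
  assumes S: "open S" "z \<in> S" and V: "subspace V" "z \<in> V"
    and f: "\<And>x. x \<in> S \<Longrightarrow> GDERIV f x :> g x"
    and tangent: "\<And>w. w \<in> S \<Longrightarrow> w \<noteq> z \<Longrightarrow> f z + g z \<bullet> (w - z) < f w"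
    and e: "e > 0"
  shows "\<exists>d>0. \<forall>c. norm c < d \<longrightarrow>
    (\<exists>z'\<in>V \<inter> S. norm (z' - z) < e \<and> (\<forall>v\<in>V. (g z' - g z - c) \<bullet> v = 0))"
proof -
  obtain r0 where r0: "r0 > 0" "cball z r0 \<subseteq> S" using S open_contains_cball by blast
  define r where "r = min r0 (e / 2)"
  have r: "r > 0" "cball z r \<subseteq> S" "r < e" using r0 e by (auto simp: r_def)
  have cf: "continuous_on S f"
    using f unfolding gderiv_def
    by (meson has_derivative_at_withinI has_derivative_continuous_on)
  \<comment> \<open>The gap between \<open>f\<close> and its tangent at \<open>z\<close> is zero at
    \<open>z\<close> and positive elsewhere on \<open>S\<close>, hence at least some
    \<open>m > 0\<close> on the compact slice of the sphere.\<close>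
  define h where "h w = f w - f z - g z \<bullet> (w - z)" for w
  have ch: "continuous_on S h" unfolding h_def by (intro continuous_intros cf)
  have cV: "closed V" by (rule closed_subspace[OF V(1)])
  have "\<exists>m>0. \<forall>w\<in>sphere z r \<inter> V. m \<le> h w"
  proof (cases "sphere z r \<inter> V = {}")
    case True then show ?thesis by (intro exI[of _ 1]) auto
  next
    case False
    have "compact (sphere z r \<inter> V)" by (intro compact_Int_closed cV compact_sphere)
    moreover have "continuous_on (sphere z r \<inter> V) h"
      using ch r by (rule_tac continuous_on_subset) auto
    ultimately obtain w0 where w0: "w0 \<in> sphere z r \<inter> V" "\<forall>w\<in>sphere z r \<inter> V. h w0 \<le> h w"
      using False continuous_attains_inf by blast
    have "w0 \<in> S" using w0 r by auto
    moreover have "w0 \<noteq> z" using w0 r by auto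
    ultimately have "h w0 > 0" using tangent[of w0] by (simp add: h_def)
    then show ?thesis using w0 by blast
  qed
  then obtain m where m: "m > 0" "\<And>w. w \<in> sphere z r \<inter> V \<Longrightarrow> m \<le> h w" by blast
  \<comment> \<open>On the sphere the tilt is worth at most \<open>norm c * r\<close>, so
    \<open>norm c < m / r\<close> keeps the tilted gap positive there, while it is 0 at
    \<open>z\<close>.\<close>
  show ?thesis
  proof (intro exI[of _ "m / r"] conjI allI impI)
    show "m / r > 0" using m r by simp
    fix c :: 'a assume c: "norm c < m / r"
    define k where "k w = h w - c \<bullet> (w - z)" for w
    have "compact (cball z r \<inter> V)" by (intro compact_Int_closed cV compact_cball)
    moreover have "continuous_on (cball z r \<inter> V) k"
      unfolding k_def using ch r by (intro continuous_intros) (rule continuous_on_subset, auto)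
    moreover have zin: "z \<in> cball z r \<inter> V" using V r by auto
    ultimately obtain z' where z': "z' \<in> cball z r \<inter> V" "\<And>w. w \<in> cball z r \<inter> V \<Longrightarrow> k z' \<le> k w"
      using continuous_attains_inf[of "cball z r \<inter> V" k] by blast
    have "z' \<notin> sphere z r"
    proof
      assume s: "z' \<in> sphere z r"
      have "c \<bullet> (z' - z) \<le> norm c * r"
        using norm_cauchy_schwarz[of c "z' - z"] s by (simp add: dist_norm norm_minus_commute)
      also have "\<dots> < m" using c r by (simp add: field_simps)
      also have "m \<le> h z'" using m s z' by auto
      finally have "k z' > 0" by (simp add: k_def)
      moreover have "k z = 0" by (simp add: k_def h_def)
      ultimately show False using z'(2)[OF zin] by simp
    qed
    then have nz: "norm (z' - z) < r" using z' by (auto simp: dist_norm norm_minus_commute)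
    have zS: "z' \<in> S" using z' r by auto
    have "(g z' - g z - c) \<bullet> v = 0" if v: "v \<in> V" for v
    proof -
      have dk: "(k has_derivative (\<lambda>x. x \<bullet> (g z' - g z - c))) (at z')"
        unfolding k_def h_def
        using f[OF zS] unfolding gderiv_def
        by (auto intro!: derivative_eq_intros simp: inner_diff_right inner_commute)
      have "((\<lambda>t. z' + t *\<^sub>R v) has_derivative (\<lambda>t. t *\<^sub>R v)) (at (0::real))"
        by (auto intro!: derivative_eq_intros)
      from has_derivative_compose[OF this, of k "\<lambda>x. x \<bullet> (g z' - g z - c)"] dk
      have "((\<lambda>t. k (z' + t *\<^sub>R v)) has_derivative (\<lambda>t. (t *\<^sub>R v) \<bullet> (g z' - g z - c))) (at 0)"
        by simp
      then have D: "DERIV (\<lambda>t. k (z' + t *\<^sub>R v)) 0 :> v \<bullet> (g z' - g z - c)"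
        by (simp add: has_field_derivative_def mult.commute[of _ "v \<bullet> _"])
      \<comment> \<open>For \<open>|t| < q\<close> the point stays in the closed ball, so
        \<open>t = 0\<close> is a local minimum along the line; the \<open>+ 1\<close> covers
        \<open>v = 0\<close>.\<close>
      define q where "q = (r - norm (z' - z)) / (norm v + 1)"
      have q: "q > 0" using nz by (simp add: q_def add_nonneg_pos)
      have "\<forall>t. \<bar>0 - t\<bar> < q \<longrightarrow> k (z' + 0 *\<^sub>R v) \<le> k (z' + t *\<^sub>R v)"
      proof (intro allI impI)
        fix t assume "\<bar>0 - t\<bar> < q"
        then have "\<bar>t\<bar> * (norm v + 1) \<le> r - norm (z' - z)"
          by (simp add: q_def pos_less_divide_eq add_nonneg_pos)
        then have "\<bar>t\<bar> * norm v \<le> r - norm (z' - z)"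
          by (smt (verit) distrib_left mult_cancel_left1)
        then have "norm (z' + t *\<^sub>R v - z) \<le> r"
          using norm_triangle_ineq[of "z' - z" "t *\<^sub>R v"] by (simp add: algebra_simps)
        then have "z' + t *\<^sub>R v \<in> cball z r \<inter> V"
          using z' v V by (auto simp: dist_norm norm_minus_commute subspace_add subspace_scale)
        then show "k (z' + 0 *\<^sub>R v) \<le> k (z' + t *\<^sub>R v)" using z'(2) by simp
      qed
      from DERIV_local_min[OF D q this] show ?thesis by (simp add: inner_commute)
    qed
    then show "\<exists>z'\<in>V \<inter> S. norm (z' - z) < e \<and> (\<forall>v\<in>V. (g z' - g z - c) \<bullet> v = 0)"
      using z'(1) zS nz r(3) by (intro bexI[of _ z']) auto
  qed
qed

section \<open>Gradients and tangent inequalities for functions of Legendre type\<close>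

lemma grad_works:
  assumes "(\<lambda>z. real_of_ereal (\<psi> z)) differentiable (at x)"
  shows "GDERIV (\<lambda>z. real_of_ereal (\<psi> z)) x :> grad \<psi> x"
proof -
  let ?f = "\<lambda>z. real_of_ereal (\<psi> z)"
  obtain f' where f': "(?f has_derivative f') (at x)"
    using assms by (auto simp: differentiable_def)
  \<comment> \<open>The adjoint of a linear functional, applied to 1, is the vector representing
    it.\<close>
  have "f' h = h \<bullet> adjoint f' 1" for h
    using adjoint_works[OF has_derivative_linear[OF f'], of h 1] by simp
  then have D: "GDERIV ?f x :> adjoint f' 1"
    using f' unfolding gderiv_def by (metis (no_types, lifting) ext)
  show ?thesis
    unfolding grad_def
  proof (rule theI[of _ "adjoint f' 1"])
    fix d assume "GDERIV ?f x :> d"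
    then have "(\<lambda>h. h \<bullet> d) = (\<lambda>h. h \<bullet> adjoint f' 1)"
      using D unfolding gderiv_def by (rule has_derivative_unique)
    then show "d = adjoint f' 1" by (metis vector_eq_rdot inner_commute)
  qed (rule D)
qed

lemma legendre_type_finite:
  assumes "legendre_type \<psi>" "x \<in> edom \<psi>"
  shows "\<psi> x = ereal (real_of_ereal (\<psi> x))"
  using assms unfolding legendre_type_def closed_proper_convex_def edom_def
  by (cases "\<psi> x") auto

lemma legendre_type_convex:
  assumes \<psi>: "legendre_type \<psi>" and x: "x \<in> edom \<psi>" and w: "w \<in> edom \<psi>" and t: "0 \<le> t" "t \<le> 1"
  shows "x + t *\<^sub>R (w - x) \<in> edom \<psi>"
    and "real_of_ereal (\<psi> (x + t *\<^sub>R (w - x))) \<le>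
         real_of_ereal (\<psi> x) + t * (real_of_ereal (\<psi> w) - real_of_ereal (\<psi> x))"
proof -
  let ?f = "\<lambda>z. real_of_ereal (\<psi> z)"
  have "convex (epi \<psi>)" using \<psi> by (simp add: legendre_type_def closed_proper_convex_def)
  moreover have "(x, ?f x) \<in> epi \<psi>" "(w, ?f w) \<in> epi \<psi>"
    using legendre_type_finite[OF \<psi>] x w by (auto simp: epi_def)
  ultimately have "(1 - t) *\<^sub>R (x, ?f x) + t *\<^sub>R (w, ?f w) \<in> epi \<psi>"
    using t by (intro convexD) auto
  then have *: "\<psi> (x + t *\<^sub>R (w - x)) \<le> ereal (?f x + t * (?f w - ?f x))"
    by (simp add: epi_def algebra_simps)
  then show mem: "x + t *\<^sub>R (w - x) \<in> edom \<psi>" by (auto simp: edom_def)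
  show "?f (x + t *\<^sub>R (w - x)) \<le> ?f x + t * (?f w - ?f x)"
    using * legendre_type_finite[OF \<psi> mem] by (metis ereal_less_eq(3))
qed

lemma legendre_type_GDERIV:
  assumes "legendre_type \<psi>" "x \<in> interior (edom \<psi>)"
  shows "GDERIV (\<lambda>z. real_of_ereal (\<psi> z)) x :> grad \<psi> x"
  using assms by (intro grad_works) (auto simp: legendre_type_def)

text \<open>Convexity bounds the difference quotients along the segment by the increment of the
  function; the limit from the right gives the slope. Allowing \<open>w\<close> on the boundary of
  the domain covers every finite competitor in the optimality proof.\<close>

lemma legendre_type_tangent:
  assumes \<psi>: "legendre_type \<psi>" and x: "x \<in> interior (edom \<psi>)" and w: "w \<in> edom \<psi>"
  shows "real_of_ereal (\<psi> x) + grad \<psi> x \<bullet> (w - x) \<le> real_of_ereal (\<psi> w)"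
proof -
  let ?f = "\<lambda>z. real_of_ereal (\<psi> z)"
  let ?k = "\<lambda>t. ?f (x + t *\<^sub>R (w - x))"
  have "((\<lambda>t. x + t *\<^sub>R (w - x)) has_derivative (\<lambda>t. t *\<^sub>R (w - x))) (at (0::real))"
    by (auto intro!: derivative_eq_intros)
  from has_derivative_compose[OF this, of ?f "\<lambda>h. h \<bullet> grad \<psi> x"]
  have "(?k has_derivative (\<lambda>t. (t *\<^sub>R (w - x)) \<bullet> grad \<psi> x)) (at 0)"
    using legendre_type_GDERIV[OF \<psi> x] by (simp add: gderiv_def)
  then have "DERIV ?k 0 :> (w - x) \<bullet> grad \<psi> x"
    by (simp add: has_field_derivative_def mult.commute[of _ "(w - x) \<bullet> _"])
  then have "((\<lambda>t. (?k t - ?k 0) / t) \<longlongrightarrow> (w - x) \<bullet> grad \<psi> x) (at_right 0)"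
    unfolding DERIV_def using filterlim_at_split by (metis (no_types, lifting) add_0 ext)
  moreover have "\<forall>\<^sub>F t in at_right 0. (?k t - ?k 0) / t \<le> ?f w - ?f x"
    unfolding eventually_at_right_field
  proof (intro exI[of _ 1] conjI allI impI)
    fix t :: real assume t: "0 < t" "t < 1"
    have "?k t - ?k 0 \<le> t * (?f w - ?f x)"
      using legendre_type_convex(2)[OF \<psi> subsetD[OF interior_subset x] w, of t] t by simp
    then show "(?k t - ?k 0) / t \<le> ?f w - ?f x"
      using t by (simp add: divide_le_eq mult.commute)
  qed simp
  ultimately have "(w - x) \<bullet> grad \<psi> x \<le> ?f w - ?f x"
    using tendsto_upperbound by fastforce
  then show ?thesis by (simp add: inner_commute)
qed

text \<open>The midpoint value is strictly below the mean of the endpoint values, while the tangent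
  at \<open>x\<close> bounds it from below; combining the two gives strictness at
  \<open>w\<close>.\<close>

lemma legendre_type_strict_tangent:
  assumes \<psi>: "legendre_type \<psi>" and x: "x \<in> interior (edom \<psi>)" and w: "w \<in> interior (edom \<psi>)"
    and ne: "w \<noteq> x"
  shows "real_of_ereal (\<psi> x) + grad \<psi> x \<bullet> (w - x) < real_of_ereal (\<psi> w)"
proof -
  let ?f = "\<lambda>z. real_of_ereal (\<psi> z)"
  let ?m = "x + (1/2) *\<^sub>R (w - x)"
  have xw: "x \<in> edom \<psi>" "w \<in> edom \<psi>" using x w interior_subset by auto
  have m: "?m \<in> edom \<psi>" using legendre_type_convex(1)[OF \<psi> xw, of "1/2"] by simp
  have "?m = (1/2) *\<^sub>R x + (1/2) *\<^sub>R w"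
    by (simp add: algebra_simps flip: scaleR_left_distrib)
  then have "\<psi> ?m < ereal (1/2) * \<psi> x + ereal (1/2) * \<psi> w"
    using \<psi> x w ne unfolding legendre_type_def
    by (metis (no_types, opaque_lifting) field_sum_of_halves half_gt_zero zero_less_one)
  then have "?f ?m < (1/2) * ?f x + (1/2) * ?f w"
    using legendre_type_finite[OF \<psi> m] legendre_type_finite[OF \<psi> xw(1)]
      legendre_type_finite[OF \<psi> xw(2)]
    by (metis less_ereal.simps(1) plus_ereal.simps(1) times_ereal.simps(1))
  moreover have "?f x + (1/2) * (grad \<psi> x \<bullet> (w - x)) \<le> ?f ?m"
    using legendre_type_tangent[OF \<psi> x m] by simp
  ultimately show ?thesis by simp
qed

section \<open>Local stability\<close>

lemma entries_in_nth [simp]: "entries_in B v $ i = (if i \<in> B then v $ i else 0)"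
  by (simp add: entries_in_def)

lemma rows_in_mult: "rows_in B D *v x = entries_in B (D *v x)"
  by (simp add: vec_eq_iff rows_in_def matrix_vector_mult_def)

lemma transpose_rows_in_mult:
  "transpose (rows_in B D) *v u = transpose D *v entries_in B u"
  by (auto simp: vec_eq_iff rows_in_def matrix_vector_mult_def transpose_def intro!: sum.cong)

lemma null_space_rows_in: "null_space (rows_in B D) = {x. \<forall>i\<in>B. (D *v x) $ i = 0}"
  by (auto simp: null_space_def rows_in_mult vec_eq_iff)

text \<open>Testing on \<open>L\<close> says that \<open>transpose X *v v\<close> and
  \<open>l *\<^sub>R c\<close> have the same projection onto \<open>L\<close>. This is a linear
  system for \<open>v\<close>, and \<open>K_set\<close> is a particular solution plus the null
  space.\<close>

lemma K_setI:
  assumes s: "s \<in> sign_vectors B"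
    and v: "\<And>w. w \<in> null_space (rows_in (- B) D) \<Longrightarrow> v \<bullet> (X *v w) = l * (s \<bullet> (D *v w))"
  shows "v \<in> K_set X D l B s"
proof -
  define L where "L = null_space (rows_in (- B) D)"
  have L: "subspace L" by (simp add: L_def subspace_null_space)
  define P where "P = proj_mat L"
  define A where "A = P ** transpose X"
  define c where "c = transpose (rows_in B D) *v s"
  have "entries_in B s = s" using s by (auto simp: vec_eq_iff sign_vectors_def)
  then have c: "c = transpose D *v s" by (simp only: c_def transpose_rows_in_mult)
  have "w \<bullet> (transpose X *v v - l *\<^sub>R c) = 0" if "w \<in> L" for w
    using v[of w] that inner_transpose[of X v w] inner_transpose[of D s w]
    by (simp add: c L_def inner_diff_right inner_commute del: transpose_matrix_vector)
  then have "P *v (transpose X *v v - l *\<^sub>R c) = 0"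
    unfolding P_def proj_mat_zero_iff[OF L] by (simp add: orthogonal_comp_def orthogonal_def)
  then have Av: "A *v v = l *\<^sub>R (P *v c)"
    by (simp add: A_def matrix_vector_mult_diff_distrib matrix_vector_mult_scaleR
        flip: matrix_vector_mul_assoc)
  \<comment> \<open>\<open>K_set\<close> applies the pseudoinverse to \<open>c\<close>, not to its
    projection. The difference is killed by \<open>transpose A\<close>, so
    \<open>A ** pinv A\<close> does not see it.\<close>
  have "P *v (c - P *v c) = 0"
    unfolding P_def proj_mat_zero_iff[OF L] by (rule proj_mat_diff[OF L])
  then have "transpose A *v (c - P *v c) = 0"
    unfolding A_def matrix_transpose_mul transpose_transpose P_def transpose_proj_mat[OF L]
    by (simp flip: matrix_vector_mul_assoc)
  then have "A *v (pinv A *v c) = A *v (pinv A *v (P *v c))"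
    using mult_pinv_transpose[of A "c - P *v c"] by (simp add: matrix_vector_mult_diff_distrib)
  then have "A *v (l *\<^sub>R (pinv A *v c)) = A *v (pinv A *v (A *v v))"
    by (simp add: Av matrix_vector_mult_scaleR)
  then have "v - l *\<^sub>R (pinv A *v c) \<in> null_space A"
    by (simp add: null_space_def matrix_vector_mult_diff_distrib mult_pinv_mult)
  then have "l *\<^sub>R (pinv A *v c) + (v - l *\<^sub>R (pinv A *v c)) \<in> K_set X D l B s"
    unfolding K_set_def Let_def A_def P_def L_def c_def
    by (intro set_plus_intro) auto
  then show ?thesis by simp
qed

text \<open>The pseudoinverse takes values in the range of \<open>proj_mat L ** transpose X\<close>,
  so in \<open>L\<close>, where the projection is the identity. It therefore lifts points of the
  image of \<open>L\<close> under \<open>X\<close> back to \<open>L\<close>.\<close>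

lemma pinv_mult_proj:
  assumes L: "subspace L"
  shows "pinv (X ** proj_mat L) *v z \<in> L"
    and "w \<in> L \<Longrightarrow> X *v (pinv (X ** proj_mat L) *v (X *v w)) = X *v w"
proof -
  let ?A = "X ** proj_mat L"
  show in_L: "pinv ?A *v z \<in> L" for z
  proof -
    obtain q where "pinv ?A *v z = transpose ?A *v q"
      using pinv_in_orthogonal_comp[of ?A z] unfolding orthogonal_comp_null_space by blast
    also have "\<dots> = proj_mat L *v (transpose X *v q)"
      by (simp only: matrix_transpose_mul transpose_proj_mat[OF L] matrix_vector_mul_assoc)
    finally show ?thesis using proj_mat_in[OF L] by simp
  qed
  have A: "?A *v w = X *v w" if "w \<in> L" for w
    using that by (simp add: proj_mat_id[OF L] flip: matrix_vector_mul_assoc)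
  show "X *v (pinv ?A *v (X *v w)) = X *v w" if "w \<in> L"
    using mult_pinv_mult[of ?A w] A[OF that] A[OF in_L] by simp
qed

text \<open>The lift \<open>u\<close> of \<open>X *v \<beta>\<close> differs from \<beta> by an
  element of \<open>null_space X \<inter> L\<close>, and \<open>E\<close> kills \<beta>. So
  \<open>E *v u\<close> lies in the very subspace that the projection in \<open>M_mat\<close>
  removes.\<close>

lemma M_mat_mult:
  assumes "\<beta> \<in> null_space (rows_in (- A) D)" and AB: "A \<subseteq> B"
  shows "M_mat X D A B *v (X *v \<beta>) = 0"
proof -
  define L where "L = null_space (rows_in (- B) D)"
  have L: "subspace L" by (simp add: L_def subspace_null_space)
  define E where "E = rows_in (B - A) D"
  define W where "W = (\<lambda>x. E *v x) ` (null_space X \<inter> L)"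
  define u where "u = pinv (X ** proj_mat L) *v (X *v \<beta>)"
  have W: "subspace W"
    unfolding W_def
    by (intro linear_subspace_image matrix_vector_mul_linear subspace_inter subspace_null_space L)
  have \<beta>: "\<beta> \<in> L" "E *v \<beta> = 0"
    using assms by (auto simp: L_def E_def null_space_rows_in rows_in_mult vec_eq_iff)
  have u: "u \<in> L" "X *v u = X *v \<beta>"
    unfolding u_def using pinv_mult_proj[OF L] \<beta> by auto
  have "u - \<beta> \<in> null_space X \<inter> L"
    using u \<beta> subspace_diff[OF L] by (auto simp: null_space_def matrix_vector_mult_diff_distrib)
  moreover have "E *v u = E *v (u - \<beta>)"
    by (simp add: \<beta> matrix_vector_mult_diff_distrib)
  ultimately have "E *v u \<in> W" unfolding W_def by blast
  then have "proj_mat (W\<^sup>\<bottom>) *v (E *v u) = 0"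
    using proj_mat_zero_iff[OF subspace_orthogonal_comp] orthogonal_comp_self[OF W] by blast
  then show ?thesis
    by (simp add: M_mat_def Let_def u_def W_def E_def L_def flip: matrix_vector_mul_assoc)
qed

text \<open>If \<open>M\<close> vanishes, the rows in \<open>B - A\<close> of a lift can be
  cancelled by an element of \<open>L\<close> that \<open>X\<close> kills; this moves the lift into
  the smaller null space without changing its image.\<close>

lemma M_mat_zero_image:
  assumes M: "M_mat X D A B = 0" and AB: "A \<subseteq> B"
  shows "(*v) X ` null_space (rows_in (- A) D) = (*v) X ` null_space (rows_in (- B) D)"
proof
  show "(*v) X ` null_space (rows_in (- A) D) \<subseteq> (*v) X ` null_space (rows_in (- B) D)"
    using AB by (intro image_mono) (auto simp: null_space_rows_in)
  define L where "L = null_space (rows_in (- B) D)"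
  have L: "subspace L" by (simp add: L_def subspace_null_space)
  define E where "E = rows_in (B - A) D"
  define W where "W = (\<lambda>x. E *v x) ` (null_space X \<inter> L)"
  have W: "subspace W"
    unfolding W_def
    by (intro linear_subspace_image matrix_vector_mul_linear subspace_inter subspace_null_space L)
  show "(*v) X ` null_space (rows_in (- B) D) \<subseteq> (*v) X ` null_space (rows_in (- A) D)"
  proof clarify
    fix w assume "w \<in> null_space (rows_in (- B) D)"
    then have w: "w \<in> L" by (simp add: L_def)
    define u where "u = pinv (X ** proj_mat L) *v (X *v w)"
    have u: "u \<in> L" "X *v u = X *v w"
      unfolding u_def using pinv_mult_proj[OF L] w by auto
    have "proj_mat (W\<^sup>\<bottom>) *v (E *v u) = M_mat X D A B *v (X *v w)"
      by (simp add: M_mat_def Let_def u_def W_def E_def L_def flip: matrix_vector_mul_assoc)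
    then have "E *v u \<in> W"
      using M proj_mat_zero_iff[OF subspace_orthogonal_comp] orthogonal_comp_self[OF W] by auto
    then obtain n where n: "X *v n = 0" "n \<in> L" "E *v u = E *v n"
      unfolding W_def by (auto simp: null_space_def)
    have "(D *v (u - n)) $ i = 0" if "i \<notin> A" for i
    proof (cases "i \<in> B")
      case True
      then show ?thesis
        using arg_cong[OF n(3), of "\<lambda>v. v $ i"] that
        by (simp add: E_def rows_in_mult matrix_vector_mult_diff_distrib)
    next
      case False
      then show ?thesis
        using subspace_diff[OF L u(1) n(2)] by (simp add: L_def null_space_rows_in)
    qed
    then have "u - n \<in> null_space (rows_in (- A) D)" by (auto simp: null_space_rows_in)
    moreover have "X *v w = X *v (u - n)"
      using u n by (simp add: matrix_vector_mult_diff_distrib)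
    ultimately show "X *v w \<in> (*v) X ` null_space (rows_in (- A) D)" by blast
  qed
qed

section \<open>KKT pairs: optimality and the exceptional set\<close>

lemma kkt_pairD:
  assumes "kkt_pair X D l \<psi> y \<beta> \<gamma>"
  shows "X *v \<beta> \<in> interior (edom \<psi>)"
    and "transpose X *v (y - grad \<psi> (X *v \<beta>)) = l *\<^sub>R (transpose D *v \<gamma>)"
    and "if (D *v \<beta>) $ i \<noteq> 0 then \<gamma> $ i = sgn ((D *v \<beta>) $ i) else \<gamma> $ i \<in> {-1..1}"
  using assms[unfolded kkt_pair_def, THEN conjunct1]
    assms[unfolded kkt_pair_def, THEN conjunct2, THEN conjunct1]
    assms[unfolded kkt_pair_def, THEN conjunct2, THEN conjunct2, THEN spec, of i]
  by -

text \<open>Two subgradient inequalities are added: the tangent inequality of \<psi>, and that of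
  the l1 norm with subgradient \<gamma> at \<open>D *v \<beta>\<close>. Stationarity cancels the
  linear terms.\<close>

lemma kkt_pair_solution:
  assumes \<psi>: "legendre_type \<psi>" and l: "l > 0" and kkt: "kkt_pair X D l \<psi> y \<beta> \<gamma>"
  shows "is_solution X D l \<psi> y \<beta>"
  unfolding is_solution_def is_arg_min_linorder
proof (intro conjI allI impI)
  fix b
  let ?f = "\<lambda>z. real_of_ereal (\<psi> z)"
  have int: "X *v \<beta> \<in> interior (edom \<psi>)"
    and stat: "transpose X *v (y - grad \<psi> (X *v \<beta>)) = l *\<^sub>R (transpose D *v \<gamma>)"
    and sg: "\<And>i. if (D *v \<beta>) $ i \<noteq> 0 then \<gamma> $ i = sgn ((D *v \<beta>) $ i) else \<gamma> $ i \<in> {-1..1}"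
    by (fact kkt_pairD[OF kkt])+
  have fin: "\<psi> (X *v \<beta>) = ereal (?f (X *v \<beta>))"
    using legendre_type_finite[OF \<psi>] int interior_subset by blast
  show "objective X D l \<psi> y \<beta> \<le> objective X D l \<psi> y b"
  proof (cases "X *v b \<in> edom \<psi>")
    case False
    then show ?thesis by (simp add: edom_def objective_def)
  next
    case True
    have "(y - grad \<psi> (X *v \<beta>)) \<bullet> (X *v (b - \<beta>)) = l * (\<gamma> \<bullet> (D *v (b - \<beta>)))"
      using inner_transpose[of X "y - grad \<psi> (X *v \<beta>)" "b - \<beta>"] inner_transpose[of D \<gamma> "b - \<beta>"]
      unfolding stat by (simp del: transpose_matrix_vector)
    moreover have "?f (X *v \<beta>) + grad \<psi> (X *v \<beta>) \<bullet> (X *v (b - \<beta>)) \<le> ?f (X *v b)"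
      using legendre_type_tangent[OF \<psi> int True] by (simp add: matrix_vector_mult_diff_distrib)
    moreover have "l * (\<gamma> \<bullet> (D *v \<beta>)) = l * (\<Sum>i\<in>UNIV. \<bar>(D *v \<beta>) $ i\<bar>)"
    proof -
      have "\<gamma> $ i * (D *v \<beta>) $ i = \<bar>(D *v \<beta>) $ i\<bar>" for i
        using sg[of i] by (cases "(D *v \<beta>) $ i = 0") (auto simp: abs_sgn mult.commute)
      then show ?thesis by (simp add: inner_vec_def)
    qed
    moreover have "l * (\<gamma> \<bullet> (D *v b)) \<le> l * (\<Sum>i\<in>UNIV. \<bar>(D *v b) $ i\<bar>)"
    proof -
      have "\<gamma> $ i * (D *v b) $ i \<le> \<bar>(D *v b) $ i\<bar>" for i
      proof -
        have "\<bar>\<gamma> $ i\<bar> \<le> 1"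
          using sg[of i] by (cases "(D *v \<beta>) $ i = 0") (auto simp: sgn_real_def)
        then have "\<bar>\<gamma> $ i * (D *v b) $ i\<bar> \<le> \<bar>(D *v b) $ i\<bar>"
          by (simp add: abs_mult mult_left_le_one_le)
        then show ?thesis by linarith
      qed
      then show ?thesis using l by (auto simp: inner_vec_def intro!: mult_left_mono sum_mono)
    qed
    ultimately have "- (y \<bullet> (X *v \<beta>)) + ?f (X *v \<beta>) + l * (\<Sum>i\<in>UNIV. \<bar>(D *v \<beta>) $ i\<bar>)
        \<le> - (y \<bullet> (X *v b)) + ?f (X *v b) + l * (\<Sum>i\<in>UNIV. \<bar>(D *v b) $ i\<bar>)"
      by (simp add: matrix_vector_mult_diff_distrib inner_diff_left inner_diff_right algebra_simps)
    moreover have "objective X D l \<psi> y b =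
        ereal (- (y \<bullet> (X *v b)) + ?f (X *v b) + l * (\<Sum>i\<in>UNIV. \<bar>(D *v b) $ i\<bar>))"
      unfolding objective_def by (subst legendre_type_finite[OF \<psi> True]) simp
    moreover have "objective X D l \<psi> y \<beta> =
        ereal (- (y \<bullet> (X *v \<beta>)) + ?f (X *v \<beta>) + l * (\<Sum>i\<in>UNIV. \<bar>(D *v \<beta>) $ i\<bar>))"
      unfolding objective_def by (subst fin) simp
    ultimately show ?thesis by simp
  qed
qed simp

text \<open>Since \<open>\<beta>\<close> is annihilated by \<open>M_mat X D A B\<close>, the point \<open>y\<close> would lie in \<open>N_set X D l \<psi>\<close> if this
  matrix were nonzero.\<close>

lemma kkt_pair_image_eq:
  assumes y: "y \<notin> N_set X D l \<psi>" and kkt: "kkt_pair X D l \<psi> y \<beta> \<gamma>"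
  shows "active_set D \<beta> \<subseteq> boundary_set \<gamma>"
    and "(*v) X ` null_space (rows_in (- active_set D \<beta>) D) =
         (*v) X ` null_space (rows_in (- boundary_set \<gamma>) D)"
proof -
  let ?A = "active_set D \<beta>" and ?B = "boundary_set \<gamma>" and ?s = "boundary_signs \<gamma>"
  let ?L = "null_space (rows_in (- ?B) D)"
  have int: "X *v \<beta> \<in> interior (edom \<psi>)"
    and stat: "transpose X *v (y - grad \<psi> (X *v \<beta>)) = l *\<^sub>R (transpose D *v \<gamma>)"
    and sg: "\<And>i. (D *v \<beta>) $ i \<noteq> 0 \<Longrightarrow> \<gamma> $ i = sgn ((D *v \<beta>) $ i)"
    using kkt_pairD[OF kkt] by meson+
  show AB: "?A \<subseteq> ?B" using sg by (auto simp: active_set_def boundary_set_def sgn_real_def)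
  have \<beta>A: "\<beta> \<in> null_space (rows_in (- ?A) D)"
    by (auto simp: null_space_rows_in active_set_def)
  have \<beta>L: "\<beta> \<in> ?L" using \<beta>A AB by (auto simp: null_space_rows_in)
  have s: "?s \<in> sign_vectors ?B"
    by (auto simp: sign_vectors_def boundary_signs_def boundary_set_def sgn_vec_def sgn_real_def)
  have s_nth: "?s $ i = \<gamma> $ i" if "i \<in> ?B" for i
    using that by (auto simp: boundary_signs_def boundary_set_def sgn_vec_def sgn_real_def abs_if
        split: if_splits)
  have "y - grad \<psi> (X *v \<beta>) \<in> K_set X D l ?B ?s"
  proof (rule K_setI[OF s])
    fix w assume w: "w \<in> ?L"
    have "(y - grad \<psi> (X *v \<beta>)) \<bullet> (X *v w) = l * (\<gamma> \<bullet> (D *v w))"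
      using inner_transpose[of X "y - grad \<psi> (X *v \<beta>)" w] inner_transpose[of D \<gamma> w]
      unfolding stat by (simp del: transpose_matrix_vector)
    \<comment> \<open>For \<open>w\<close> in \<open>?L\<close> the vector \<open>D *v w\<close>
      vanishes off the boundary set, and on it \<gamma> coincides with its signs.\<close>
    moreover have "\<gamma> $ i * (D *v w) $ i = ?s $ i * (D *v w) $ i" for i
      using s_nth[of i] w by (cases "i \<in> ?B") (auto simp: null_space_rows_in)
    ultimately show "(y - grad \<psi> (X *v \<beta>)) \<bullet> (X *v w) = l * (?s \<bullet> (D *v w))"
      by (simp add: inner_vec_def)
  qed
  moreover have "X *v \<beta> \<in> col_space (X ** proj_mat ?L)"
  proof -
    have "X *v \<beta> = (X ** proj_mat ?L) *v \<beta>"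
      by (simp add: proj_mat_id[OF subspace_null_space \<beta>L] flip: matrix_vector_mul_assoc)
    then show ?thesis
      by (simp add: col_space_def matrix_vector_mult_in_columnspace)
  qed
  moreover have "X *v \<beta> \<in> null_space (M_mat X D ?A ?B)"
    using M_mat_mult[OF \<beta>A AB] by (simp add: null_space_def)
  ultimately have "y - grad \<psi> (X *v \<beta>) + grad \<psi> (X *v \<beta>) \<in> K_set X D l ?B ?s + grad \<psi> `
      (col_space (X ** proj_mat ?L) \<inter> null_space (M_mat X D ?A ?B) \<inter> interior (edom \<psi>))"
    using int by (intro set_plus_intro) auto
  then have "M_mat X D ?A ?B \<noteq> 0 \<Longrightarrow> y \<in> N_set X D l \<psi>"
    using AB s unfolding N_set_def by auto
  then have "M_mat X D ?A ?B = 0" using y by blast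
  then show "(*v) X ` null_space (rows_in (- ?A) D) = (*v) X ` ?L"
    using M_mat_zero_image AB by blast
qed

section \<open>Construction of the perturbed pair\<close>

theorem lemma18:
  fixes X :: "real^'p^'n" and D :: "real^'p^'m" and l :: real
    and \<psi> :: "real^'n \<Rightarrow> ereal" and y :: "real^'n"
    and \<beta> :: "real^'p" and \<gamma> :: "real^'m"
  assumes "l > 0"
    and "legendre_type \<psi>"
    and "0 \<in> interior (edom \<psi>)"
    and "y \<in> - N_set X D l \<psi> \<inter> (interior (grad \<psi> ` interior (edom \<psi>)) + C_set X D l)"
    and "kkt_pair X D l \<psi> y \<beta> \<gamma>"
  shows "\<exists>U. open U \<and> y \<in> U \<and>
           (\<forall>y'\<in>U. \<exists>\<beta>' \<gamma>'.
              is_solution X D l \<psi> y' \<beta>' \<and>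
              kkt_pair X D l \<psi> y' \<beta>' \<gamma>' \<and>
              boundary_set \<gamma>' = boundary_set \<gamma> \<and>
              boundary_signs \<gamma>' = boundary_signs \<gamma> \<and>
              active_set D \<beta>' = active_set D \<beta> \<and>
              active_signs D \<beta>' \<gamma>' = active_signs D \<beta> \<gamma>)"
proof -
  note l = assms(1) and \<psi> = assms(2) and kkt = assms(5)
  let ?A = "active_set D \<beta>" and ?B = "boundary_set \<gamma>" and ?S = "interior (edom \<psi>)"
  let ?F = "rows_in (- ?B) D" and ?g = "grad \<psi>"
  define L where "L = null_space (rows_in (- ?A) D)"
  define V where "V = (*v) X ` L"
  define z where "z = X *v \<beta>"
  have z: "z \<in> ?S"
    and stat: "transpose X *v (y - ?g z) = l *\<^sub>R (transpose D *v \<gamma>)"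
    and sg: "\<And>i. if (D *v \<beta>) $ i \<noteq> 0 then \<gamma> $ i = sgn ((D *v \<beta>) $ i) else \<gamma> $ i \<in> {-1..1}"
    unfolding z_def by (fact kkt_pairD[OF kkt])+
  \<comment> \<open>Both descriptions of \<open>V\<close> are needed: as the image of
    \<open>L\<close> it admits lifts that keep inactive rows zero; as the image of the larger null
    space it is where stationarity is tested.\<close>
  have AB: "?A \<subseteq> ?B" and VB: "V = (*v) X ` null_space ?F"
    using kkt_pair_image_eq[OF _ kkt] assms(4) by (auto simp: V_def L_def)
  have L: "subspace L" by (simp add: L_def subspace_null_space)
  have V: "subspace V"
    unfolding V_def by (intro linear_subspace_image matrix_vector_mul_linear L)
  have \<beta>: "\<beta> \<in> L" by (auto simp: L_def null_space_rows_in active_set_def)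
  then have zV: "z \<in> V" by (auto simp: V_def z_def)
  obtain T where T: "range T \<subseteq> L" "linear T" "\<And>v. v \<in> V \<Longrightarrow> X *v T v = v"
    using linear_exists_right_inverse_on[OF matrix_vector_mul_linear[of X] L] by (auto simp: V_def)
  obtain R where R: "linear R"
      "\<And>v. v \<in> range ((*v) (transpose ?F)) \<Longrightarrow> transpose ?F *v R v = v"
    using linear_exists_right_inverse_on[OF matrix_vector_mul_linear[of "transpose ?F"] subspace_UNIV]
    by auto
  \<comment> \<open>\<open>b\<close> lifts fitted values, with \<open>b z = \<beta>\<close>;
    \<open>\<delta> v\<close> is the multiplier correction that offsets a residual \<open>v\<close>.
    Both are continuous, so strict inequalities survive small changes.\<close>
  define b where "b x = \<beta> + T (x - z)" for x
  define \<delta> where "\<delta> v = R ((1 / l) *\<^sub>R (transpose X *v v))" for v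
  have cb: "isCont b x" for x
    unfolding b_def
    by (intro continuous_intros linear_continuous_compose[OF _ T(2)])
  have c\<delta>: "isCont \<delta> x" for x
    unfolding \<delta>_def
    by (intro continuous_intros linear_continuous_compose[OF _ R(1)]
        linear_continuous_compose[OF _ matrix_vector_mul_linear])
  \<comment> \<open>A positive product means equal nonzero signs; at \<open>z\<close> it is the
    square of a nonzero number.\<close>
  have "\<forall>\<^sub>F x in nhds z. \<forall>i\<in>?A. (D *v b x) $ i * (D *v \<beta>) $ i > 0"
  proof (intro eventually_ball_finite ballI)
    fix i assume i: "i \<in> ?A"
    have c: "isCont (\<lambda>x. (D *v b x) $ i * (D *v \<beta>) $ i) z"
      by (intro continuous_intros linear_continuous_compose[OF cb matrix_vector_mul_linear])
    have "(D *v b z) $ i * (D *v \<beta>) $ i > 0"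
      using i linear_0[OF T(2)] by (simp add: b_def active_set_def zero_less_mult_iff) linarith
    then show "\<forall>\<^sub>F x in nhds z. (D *v b x) $ i * (D *v \<beta>) $ i > 0"
      by (rule order_tendstoD(1)[OF iffD1[OF tendsto_at_iff_tendsto_nhds c[unfolded isCont_def]]])
  qed simp
  then obtain e1 where e1: "e1 > 0"
      "\<And>x i. norm (x - z) < e1 \<Longrightarrow> i \<in> ?A \<Longrightarrow> (D *v b x) $ i * (D *v \<beta>) $ i > 0"
    by (auto simp: eventually_nhds_metric dist_norm)
  \<comment> \<open>Off \<open>?B\<close> the bound on \<gamma> is strict and
    \<open>\<delta> 0 = 0\<close>; finitely many indices give a common radius.\<close>
  have "\<forall>\<^sub>F v in nhds 0. \<forall>i\<in>- ?B. \<bar>\<gamma> $ i + \<delta> v $ i\<bar> < 1"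
  proof (intro eventually_ball_finite ballI)
    fix i assume i: "i \<in> - ?B"
    have c: "isCont (\<lambda>v. \<bar>\<gamma> $ i + \<delta> v $ i\<bar>) 0"
      by (intro continuous_intros c\<delta>)
    have "\<bar>\<gamma> $ i + \<delta> 0 $ i\<bar> < 1"
      using i sg[of i] AB linear_0[OF R(1)]
      by (auto simp: \<delta>_def boundary_set_def active_set_def split: if_splits)
    then show "\<forall>\<^sub>F v in nhds 0. \<bar>\<gamma> $ i + \<delta> v $ i\<bar> < 1"
      by (rule order_tendstoD(2)[OF iffD1[OF tendsto_at_iff_tendsto_nhds c[unfolded isCont_def]]])
  qed simp
  then obtain e2 where e2: "e2 > 0"
      "\<And>v i. norm v < e2 \<Longrightarrow> i \<notin> ?B \<Longrightarrow> \<bar>\<gamma> $ i + \<delta> v $ i\<bar> < 1"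
    by (auto simp: eventually_nhds_metric dist_norm)
  \<comment> \<open>The residual comes from the change of datum and the change of gradient; each is
    allowed \<open>e2 / 2\<close>.\<close>
  obtain e3 where e3: "e3 > 0" "\<And>x. x \<in> ?S \<Longrightarrow> norm (x - z) < e3 \<Longrightarrow> norm (?g x - ?g z) \<le> e2 / 2"
    using grad_continuous[OF open_interior z legendre_type_GDERIV[OF \<psi> z]
        legendre_type_tangent[OF \<psi> _ subsetD[OF interior_subset]] half_gt_zero[OF e2(1)]] by blast
  have "min e1 e3 > 0" using e1(1) e3(1) by simp
  then obtain d where d: "d > 0" "\<And>c. norm c < d \<Longrightarrow>
      \<exists>z'\<in>V \<inter> ?S. norm (z' - z) < min e1 e3 \<and> (\<forall>v\<in>V. (?g z' - ?g z - c) \<bullet> v = 0)"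
    using perturbed_stationary_point[OF open_interior z V zV legendre_type_GDERIV[OF \<psi>]
        legendre_type_strict_tangent[OF \<psi> z], of "min e1 e3"] by blast
  show ?thesis
  proof (intro exI[of _ "ball y (min d (e2 / 2))"] conjI ballI)
    fix y' assume "y' \<in> ball y (min d (e2 / 2))"
    then have y': "norm (y' - y) < d" "norm (y' - y) < e2 / 2"
      by (auto simp: dist_norm norm_minus_commute)
    obtain z' where z': "z' \<in> V" "z' \<in> ?S" "norm (z' - z) < e1" "norm (z' - z) < e3"
        "\<And>v. v \<in> V \<Longrightarrow> (?g z' - ?g z - (y' - y)) \<bullet> v = 0"
      using d(2)[OF y'(1)] unfolding min_less_iff_conj by blast
    \<comment> \<open>The part of \<open>y' - ?g z'\<close> not yet balanced by the old multiplier,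
      since \<open>y' - ?g z' = (y - ?g z) + v\<close>.\<close>
    define v where "v = (y' - y) - (?g z' - ?g z)"
    define \<beta>' where "\<beta>' = b z'"
    define \<gamma>' where "\<gamma>' = \<gamma> + entries_in (- ?B) (\<delta> v)"
    have "norm v < e2"
      using norm_triangle_ineq4[of "y' - y" "?g z' - ?g z"] y'(2) e3(2)[OF z'(2,4)]
      by (simp add: v_def)
    then have \<gamma>'_out: "\<bar>\<gamma>' $ i\<bar> < 1" if "i \<notin> ?B" for i
      using e2(2) that by (simp add: \<gamma>'_def)
    have \<gamma>'_in: "\<gamma>' $ i = \<gamma> $ i" if "i \<in> ?B" for i using that by (simp add: \<gamma>'_def)
    have B': "boundary_set \<gamma>' = ?B"
      using \<gamma>'_out \<gamma>'_in by (force simp: boundary_set_def)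
    have \<beta>'L: "\<beta>' \<in> L"
      unfolding \<beta>'_def b_def using T(1) by (intro subspace_add L \<beta>) auto
    have X\<beta>': "X *v \<beta>' = z'"
      using T(3)[OF subspace_diff[OF V z'(1) zV]]
      by (simp add: \<beta>'_def b_def matrix_vector_right_distrib flip: z_def)
    have sgn_eq: "sgn ((D *v \<beta>') $ i) = sgn ((D *v \<beta>) $ i)" for i
    proof (cases "i \<in> ?A")
      case True
      then show ?thesis
        using e1(2)[OF z'(3) True] by (auto simp: \<beta>'_def zero_less_mult_iff)
    next
      case False
      then show ?thesis using \<beta>'L by (simp add: L_def null_space_rows_in active_set_def)
    qed
    then have zero_iff: "(D *v \<beta>') $ i = 0 \<longleftrightarrow> (D *v \<beta>) $ i = 0" for i
      by (metis sgn_0_0)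
    have A': "active_set D \<beta>' = ?A" by (simp add: active_set_def zero_iff)
    \<comment> \<open>\<open>v\<close> is orthogonal to \<open>V\<close>, the image of the null
      space of \<open>?F\<close>; moving \<open>X\<close> across the inner product transfers
      this.\<close>
    have v_perp: "transpose X *v v \<in> (null_space ?F)\<^sup>\<bottom>"
      unfolding orthogonal_comp_def orthogonal_def
    proof (intro CollectI ballI)
      fix w assume "w \<in> null_space ?F"
      then have "(?g z' - ?g z - (y' - y)) \<bullet> (X *v w) = 0" using z'(5) VB by auto
      then show "w \<bullet> (transpose X *v v) = 0"
        by (simp add: v_def inner_transpose inner_commute[of w] inner_diff_left
            del: transpose_matrix_vector)
    qed
    then have "(1 / l) *\<^sub>R (transpose X *v v) \<in> range ((*v) (transpose ?F))"
      unfolding orthogonal_comp_null_space[symmetric]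
      by (intro subspace_scale subspace_orthogonal_comp)
    then have "transpose ?F *v \<delta> v = (1 / l) *\<^sub>R (transpose X *v v)"
      unfolding \<delta>_def by (rule R(2))
    \<comment> \<open>Only entries off \<open>?B\<close> enter \<open>transpose ?F\<close>, so the
      change of \<gamma> supplies exactly the missing \<open>transpose X *v v\<close>.\<close>
    then have "l *\<^sub>R (transpose D *v entries_in (- ?B) (\<delta> v)) = transpose X *v v"
      unfolding transpose_rows_in_mult using l by simp
    then have "transpose X *v (y - ?g z) + transpose X *v v = l *\<^sub>R (transpose D *v \<gamma>')"
      unfolding stat \<gamma>'_def by (simp only: matrix_vector_right_distrib scaleR_right_distrib)
    moreover have "y' - ?g z' = (y - ?g z) + v" by (simp add: v_def)
    ultimately have stat': "transpose X *v (y' - ?g z') = l *\<^sub>R (transpose D *v \<gamma>')"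
      by (simp only: matrix_vector_right_distrib)
    have kkt': "kkt_pair X D l \<psi> y' \<beta>' \<gamma>'"
      unfolding kkt_pair_def X\<beta>'
    proof (intro conjI allI stat' z'(2))
      fix i
      show "if (D *v \<beta>') $ i \<noteq> 0 then \<gamma>' $ i = sgn ((D *v \<beta>') $ i) else \<gamma>' $ i \<in> {-1..1}"
      proof (cases "i \<in> ?B")
        case True
        then show ?thesis using sg[of i] by (auto simp: \<gamma>'_in zero_iff sgn_eq split: if_splits)
      next
        case False
        then have "(D *v \<beta>') $ i = 0" using AB zero_iff by (auto simp: active_set_def)
        then show ?thesis using \<gamma>'_out[OF False] by auto
      qed
    qed
    have "boundary_signs \<gamma>' = boundary_signs \<gamma>"
      by (simp add: boundary_signs_def B' vec_eq_iff sgn_vec_def \<gamma>'_in)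
    moreover have "active_signs D \<beta>' \<gamma>' = active_signs D \<beta> \<gamma>"
      using AB by (auto simp: active_signs_def A' vec_eq_iff sgn_vec_def \<gamma>'_in)
    ultimately show "\<exists>\<beta>' \<gamma>'.
              is_solution X D l \<psi> y' \<beta>' \<and>
              kkt_pair X D l \<psi> y' \<beta>' \<gamma>' \<and>
              boundary_set \<gamma>' = boundary_set \<gamma> \<and>
              boundary_signs \<gamma>' = boundary_signs \<gamma> \<and>
              active_set D \<beta>' = active_set D \<beta> \<and>
              active_signs D \<beta>' \<gamma>' = active_signs D \<beta> \<gamma>"
      using kkt' kkt_pair_solution[OF \<psi> l kkt'] B' A' by blast
  qed (use d e2 in auto)
qed

end
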